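(* Let $X^*\in\mathbb R^{n_1\times n_2}$ be a matrix of rank $r$ and let $Z^*=\text{b-SVD}(X^* )$. Then for any $Z=\begin{pmatrix} U \\ V \end{pmatrix}\in\mathbb R^{(n_1+n_2)\times r}$ with $U\in\mathbb R^{n_1\times r}$, $V\in\mathbb R^{n_2\times r}$, $$d_P^2(Z,Z^* )\le\frac{1}{(\sqrt2-1)\,\sigma_r(X^* )}\left(\|UV^\top-X^*\|_F^2+\frac14\|U^\top U-V^\top V\|_F^2\right).$$
   Context: $\sigma_r(\cdot)$ is the $r$-th largest singular value, $\|\cdot\|_F$ the Frobenius norm. Balanced SVD: if $X\in\mathbb R^{n_1\times n_2}$ has rank $r$ and SVD $X=\bar U\Sigma\bar V^\top$ ($\bar U\in\mathbb R^{n_1\times r}$, $\bar V\in\mathbb R^{n_2\times r}$ with orthonormal columns, $\Sigma\in\mathbb R^{r\times r}$ diagonal), then $\text{b-SVD}(X)=\begin{pmatrix} \bar U\Sigma^{1/2} \\ \bar V\Sigma^{1/2} \end{pmatrix}\in\mathbb R^{(n_1+n_2)\times r}$. Procrustes distance: for $Z_1,Z_2\in\mathbb R^{N\times r}$, $d_P(Z_1,Z_2)=\min\{\|Z_1-Z_2P\|_F : P\in\mathbb R^{r\times r}\text{ orthogonal}\}$. *)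

theory Defs
  imports "HOL-Analysis.Analysis"
begin

(* Matrices with n rows and r columns have type real^'r^'n; their norm is the Frobenius norm: *)
lemma norm_matrix_frobenius:
  fixes A :: "real^'c^'b"
  shows "norm A = sqrt (\<Sum>i\<in>UNIV. \<Sum>j\<in>UNIV. (A $ i $ j)\<^sup>2)"
  by (simp add: norm_vec_def L2_set_def sum_nonneg)

definition vstack :: "real^'r^'n1 \<Rightarrow> real^'r^'n2 \<Rightarrow> real^'r^('n1 + 'n2)" where
  "vstack U V = (\<chi> i. case i of Inl a \<Rightarrow> U $ a | Inr b \<Rightarrow> V $ b)"

definition diag_matrix :: "real^'r \<Rightarrow> real^'r^'r" where
  "diag_matrix d = (\<chi> i j. if i = j then d $ i else 0)"

(* Compact SVD A = U diag(s) V^T. The diagonal entries are not required to be sorted, since the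
   index type 'r carries no order. *)
definition is_svd :: "real^'n2^'n1 \<Rightarrow> real^'r^'n1 \<Rightarrow> real^'r \<Rightarrow> real^'r^'n2 \<Rightarrow> bool" where
  "is_svd A U s V \<longleftrightarrow>
     transpose U ** U = mat 1 \<and> transpose V ** V = mat 1 \<and> (\<forall>i. 0 \<le> s $ i) \<and>
     A = U ** diag_matrix s ** transpose V"

(* A relation, because the SVD is not unique. *)
definition is_balanced_svd :: "real^'n2^'n1 \<Rightarrow> real^'r^('n1 + 'n2) \<Rightarrow> bool" where
  "is_balanced_svd A Z \<longleftrightarrow>
     (\<exists>U s V. is_svd A U s V \<and>
        Z = vstack (U ** diag_matrix (\<chi> i. sqrt (s $ i))) (V ** diag_matrix (\<chi> i. sqrt (s $ i))))"

definition singular_multiplicity :: "real^'n2^'n1 \<Rightarrow> real \<Rightarrow> nat" where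
  "singular_multiplicity A s = dim {x. (transpose A ** A) *v x = s\<^sup>2 *\<^sub>R x}"

(* The square roots of the eigenvalues of A^T A in decreasing order, with multiplicity. There is
   one for each column of A, so for a wide matrix the list has additional zeros at its end. *)
definition singular_values :: "real^'n2^'n1 \<Rightarrow> real list" where
  "singular_values A =
     concat (map (\<lambda>s. replicate (singular_multiplicity A s) s)
       (rev (sorted_list_of_set {s. 0 \<le> s \<and> 0 < singular_multiplicity A s})))"

(* The k-th largest singular value, for k = 1, 2, ... *)
definition singular_value :: "nat \<Rightarrow> real^'n2^'n1 \<Rightarrow> real" where
  "singular_value k A = singular_values A ! (k - 1)"

(* sorted_list_of_set is only meaningful for finite sets. *)
lemma finite_singular_values:
  fixes A :: "real^'n2^'n1"
  shows "finite {s. 0 \<le> s \<and> 0 < singular_multiplicity A s}" (is "finite ?S")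
proof -
  let ?M = "transpose A ** A"
  have "\<exists>x. x \<noteq> 0 \<and> ?M *v x = s\<^sup>2 *\<^sub>R x" if "s \<in> ?S" for s
  proof (rule ccontr)
    assume "\<not> ?thesis"
    then have "{x. ?M *v x = s\<^sup>2 *\<^sub>R x} \<subseteq> {0}" by auto
    then have "dim {x. ?M *v x = s\<^sup>2 *\<^sub>R x} = 0" by (simp add: dim_eq_0)
    with that show False by (simp add: singular_multiplicity_def)
  qed
  then obtain v where v: "v s \<noteq> 0" "?M *v v s = s\<^sup>2 *\<^sub>R v s" if "s \<in> ?S" for s
    by metis
  have M: "?M *v x = (A *v x) v* A" for x
    by (simp only: matrix_vector_mul_assoc[symmetric] transpose_matrix_vector)
  have M_inner: "(?M *v x) \<bullet> y = (A *v x) \<bullet> (A *v y)" for x y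
    by (simp only: M dot_lmul_matrix)
  have sym: "(?M *v x) \<bullet> y = x \<bullet> (?M *v y)" for x y
    using M_inner[of x y] M_inner[of y x] by (simp only: inner_commute)
  have orth: "v s \<bullet> v t = 0" if "s \<in> ?S" "t \<in> ?S" "s \<noteq> t" for s t
  proof -
    have "s\<^sup>2 * (v s \<bullet> v t) = t\<^sup>2 * (v s \<bullet> v t)"
      using sym[of "v s" "v t"] v that by simp
    moreover have "s\<^sup>2 \<noteq> t\<^sup>2" using that by (simp add: power2_eq_iff_nonneg)
    ultimately show ?thesis by simp
  qed
  have inj: "inj_on v ?S"
  proof (rule inj_onI, rule ccontr)
    fix s t assume st: "s \<in> ?S" "t \<in> ?S" "v s = v t" "s \<noteq> t"
    with orth[OF st(1,2,4)] have "v s \<bullet> v s = 0" by simp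
    with v(1)[OF st(1)] show False by simp
  qed
  have "finite (v ` ?S)"
  proof (rule pairwise_orthogonal_imp_finite)
    show "pairwise orthogonal (v ` ?S)"
      unfolding pairwise_def orthogonal_def using orth by blast
  qed
  with inj show ?thesis by (rule finite_imageD[rotated])
qed

definition procrustes_dist :: "real^'r^'m \<Rightarrow> real^'r^'m \<Rightarrow> real" where
  "procrustes_dist Z1 Z2 = Inf {norm (Z1 - Z2 ** P) | P. orthogonal_matrix P}"

(* The infimum is attained, so it is the minimum. *)
lemma procrustes_dist_attained:
  fixes Z1 Z2 :: "real^'r^'m"
  shows "\<exists>P. orthogonal_matrix P \<and> procrustes_dist Z1 Z2 = norm (Z1 - Z2 ** P) \<and>
    (\<forall>Q. orthogonal_matrix Q \<longrightarrow> norm (Z1 - Z2 ** P) \<le> norm (Z1 - Z2 ** Q))"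
proof -
  let ?O = "{P :: real^'r^'r. orthogonal_matrix P}"
  have cont: "continuous_on S (\<lambda>P :: real^'r^'r. B ** P)" for S and B :: "real^'r^'k"
    unfolding matrix_matrix_mult_def
    by (intro continuous_on_vec_lambda continuous_intros)
  have cont2: "continuous_on UNIV (\<lambda>P :: real^'r^'r. transpose P ** P)"
    unfolding matrix_matrix_mult_def transpose_def
    by (simp, intro continuous_on_vec_lambda continuous_intros)
  have "?O = (\<lambda>P. transpose P ** P) -` {mat 1}"
    by (auto simp: orthogonal_matrix)
  then have "closed ?O"
    using continuous_closed_vimage[of "{mat 1}" "\<lambda>P :: real^'r^'r. transpose P ** P"] cont2
    by (simp add: continuous_on_eq_continuous_at)
  moreover have "norm P \<le> sqrt (real CARD('r))" if "P \<in> ?O" for P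
  proof -
    have "norm (P $ i) = 1" for i
      using that by (simp add: orthogonal_matrix_orthonormal_rows row_def vec_nth_inverse)
    then show ?thesis by (simp add: norm_vec_def L2_set_def)
  qed
  then have "bounded ?O" by (auto simp: bounded_iff)
  ultimately have "compact ?O" by (simp add: compact_eq_bounded_closed)
  moreover have "?O \<noteq> {}" using orthogonal_matrix_id by auto
  moreover have "continuous_on ?O (\<lambda>P. norm (Z1 - Z2 ** P))"
    by (intro continuous_intros cont)
  ultimately obtain P where P: "P \<in> ?O" "\<forall>Q\<in>?O. norm (Z1 - Z2 ** P) \<le> norm (Z1 - Z2 ** Q)"
    using continuous_attains_inf by blast
  then have "procrustes_dist Z1 Z2 = norm (Z1 - Z2 ** P)"
    unfolding procrustes_dist_def by (intro cInf_eq_minimum) auto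
  with P show ?thesis by auto
qed

end

theory Submission
  imports Defs
begin

text \<open>
  Let \<open>Y\<close> be the balanced factor of \<open>Xs\<close>, \<open>Z\<close> the stacked matrix of \<open>U\<close> and \<open>V\<close>, and \<open>P\<close> the best
  orthogonal alignment. Comparing \<open>P\<close> with \<open>P Q\<close>, where \<open>Q\<close> is a reflection or a product of two
  reflections, shows that \<open>Z\<^sup>T Y P\<close> is symmetric and positive semidefinite. Put \<open>X = Y P\<close>,
  \<open>E = Z - X\<close>, \<open>H = X\<^sup>T E\<close> and \<open>N = E\<^sup>T E\<close>. Then \<open>H\<close> is symmetric, and completing the square gives
  \<open>\<parallel>Z Z\<^sup>T - Y Y\<^sup>T\<parallel>\<^sup>2 = \<parallel>N + \<surd>2 H\<parallel>\<^sup>2 + (4 - 2\<surd>2) tr (N X\<^sup>T Z) + 2 (\<surd>2 - 1) \<parallel>X E\<^sup>T\<parallel>\<^sup>2\<close>,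
  where the middle term is nonnegative and the last one is at least
  \<open>4 (\<surd>2 - 1) \<sigma>\<^sub>r \<parallel>E\<parallel>\<^sup>2\<close>, because \<open>Y\<^sup>T Y = 2 \<Sigma>\<close>. Balancedness also gives
  \<open>\<parallel>Z Z\<^sup>T - Y Y\<^sup>T\<parallel>\<^sup>2 \<le> 4 \<parallel>U V\<^sup>T - Xs\<parallel>\<^sup>2 + \<parallel>U\<^sup>T U - V\<^sup>T V\<parallel>\<^sup>2\<close>.
\<close>

section \<open>Matrix algebra and the Frobenius inner product\<close>

lemma transpose_add: "transpose (A + B) = transpose A + transpose (B :: 'a::semiring_1^'n^'m)"
  by (simp add: transpose_def vec_eq_iff)

lemma transpose_diff: "transpose (A - B) = transpose A - transpose (B :: 'a::ring_1^'n^'m)"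
  by (simp add: transpose_def vec_eq_iff)

lemma matrix_mul_diff_right:
  fixes A :: "'a::ring_1^'n^'m"
  shows "A ** (B - C) = A ** B - A ** C"
  by (simp add: matrix_matrix_mult_def vec_eq_iff right_diff_distrib sum_subtractf)

lemma matrix_add_rdistrib:
  fixes C :: "'a::semiring_1^'k^'n"
  shows "(A + B) ** C = A ** C + B ** C"
  by (simp add: matrix_matrix_mult_def vec_eq_iff distrib_right sum.distrib)

lemma matrix_inner_eq_sum:
  fixes A B :: "real^'n^'m"
  shows "A \<bullet> B = (\<Sum>i\<in>UNIV. \<Sum>j\<in>UNIV. A $ i $ j * B $ i $ j)"
  by (simp add: inner_vec_def)

lemma inner_transpose:
  fixes A B :: "real^'n^'m"
  shows "transpose A \<bullet> transpose B = A \<bullet> B"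
  unfolding matrix_inner_eq_sum transpose_def by (simp, rule sum.swap)

lemma inner_matrix_mul_left:
  fixes A :: "real^'n^'m" and B :: "real^'k^'n" and C :: "real^'k^'m"
  shows "(A ** B) \<bullet> C = B \<bullet> (transpose A ** C)"
proof -
  have "(A ** B) \<bullet> C = (\<Sum>i\<in>UNIV. \<Sum>j\<in>UNIV. \<Sum>k\<in>UNIV. A $ i $ k * B $ k $ j * C $ i $ j)"
    by (simp add: matrix_inner_eq_sum matrix_matrix_mult_def sum_distrib_right)
  also have "\<dots> = (\<Sum>i\<in>UNIV. \<Sum>k\<in>UNIV. \<Sum>j\<in>UNIV. A $ i $ k * B $ k $ j * C $ i $ j)"
    by (intro sum.cong refl sum.swap)
  also have "\<dots> = (\<Sum>k\<in>UNIV. \<Sum>i\<in>UNIV. \<Sum>j\<in>UNIV. A $ i $ k * B $ k $ j * C $ i $ j)"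
    by (rule sum.swap)
  also have "\<dots> = (\<Sum>k\<in>UNIV. \<Sum>j\<in>UNIV. \<Sum>i\<in>UNIV. A $ i $ k * B $ k $ j * C $ i $ j)"
    by (intro sum.cong refl sum.swap)
  also have "\<dots> = B \<bullet> (transpose A ** C)"
    by (simp add: matrix_inner_eq_sum matrix_matrix_mult_def transpose_def sum_distrib_left
        mult_ac)
  finally show ?thesis .
qed

lemma inner_matrix_mul_right:
  fixes A :: "real^'n^'m" and B :: "real^'k^'n" and C :: "real^'k^'m"
  shows "(A ** B) \<bullet> C = A \<bullet> (C ** transpose B)"
proof -
  have "(A ** B) \<bullet> C = (transpose B ** transpose A) \<bullet> transpose C"
    by (simp only: matrix_transpose_mul[symmetric] inner_transpose)
  also have "\<dots> = transpose A \<bullet> transpose (C ** transpose B)"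
    by (simp add: inner_matrix_mul_left matrix_transpose_mul)
  finally show ?thesis by (simp only: inner_transpose)
qed

text \<open>Both sides are the same trace, read cyclically. This turns inner products of outer
  products such as \<open>Z Z^T\<close> into inner products of small Gram matrices.\<close>

lemma inner_mul_transpose:
  fixes A B :: "real^'k^'m" and C D :: "real^'k^'n"
  shows "(A ** transpose C) \<bullet> (B ** transpose D) = (transpose A ** B) \<bullet> (transpose C ** D)"
proof -
  have "(A ** transpose C) \<bullet> (B ** transpose D) = transpose C \<bullet> ((transpose A ** B) ** transpose D)"
    by (simp add: inner_matrix_mul_left matrix_mul_assoc)
  also have "\<dots> = (transpose C ** D) \<bullet> (transpose A ** B)"
    by (simp add: inner_matrix_mul_right)
  finally show ?thesis by (simp add: inner_commute)
qed

lemma norm_add_sq: "(norm (x + y))\<^sup>2 = (norm x)\<^sup>2 + 2 * (x \<bullet> y) + (norm y)\<^sup>2"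
  for x y :: "'a::real_inner"
  by (simp add: power2_norm_eq_inner inner_add inner_commute algebra_simps)

lemma norm_diff_sq: "(norm (x - y))\<^sup>2 = (norm x)\<^sup>2 - 2 * (x \<bullet> y) + (norm y)\<^sup>2"
  for x y :: "'a::real_inner"
  by (simp add: power2_norm_eq_inner inner_diff inner_commute algebra_simps)

lemma norm_mul_orthogonal:
  fixes A :: "real^'n^'m"
  assumes "orthogonal_matrix P"
  shows "norm (A ** P) = norm A"
proof -
  have "(A ** P) \<bullet> (A ** P) = A \<bullet> A"
    using assms by (simp add: inner_matrix_mul_right matrix_mul_assoc[symmetric]
        orthogonal_matrix_def)
  then show ?thesis by (simp add: norm_eq)
qed

lemma mul_transpose_row: "(A ** transpose B) $ i = B *v (A $ i)"
  for A :: "real^'k^'m" and B :: "real^'k^'n"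
  by (simp add: matrix_matrix_mult_def matrix_vector_mult_def transpose_def vec_eq_iff mult_ac)

text \<open>Row \<open>i\<close> of \<open>A B^T\<close> is \<open>B\<close> applied to row
  \<open>i\<close> of \<open>A\<close>, so the vector bound is summed over the rows.\<close>

lemma norm_mul_transpose_lower_bound:
  fixes A :: "real^'k^'m" and B :: "real^'k^'n"
  assumes "\<And>x. c * (norm x)\<^sup>2 \<le> (norm (B *v x))\<^sup>2"
  shows "c * (norm A)\<^sup>2 \<le> (norm (A ** transpose B))\<^sup>2"
proof -
  have sq: "(norm C)\<^sup>2 = (\<Sum>i\<in>UNIV. (norm (C $ i))\<^sup>2)" for C :: "real^'l^'m"
    by (simp add: power2_norm_eq_inner inner_vec_def)
  show ?thesis
    unfolding sq mul_transpose_row sum_distrib_left by (intro sum_mono assms)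
qed

text \<open>The inner product is the sum of the values of the quadratic form of \<open>M\<close> at
  the rows of \<open>E\<close>.\<close>

lemma inner_gram_psd_nonneg:
  fixes M :: "real^'k^'k" and E :: "real^'k^'m"
  assumes "\<And>x. 0 \<le> x \<bullet> (M *v x)"
  shows "0 \<le> (transpose E ** E) \<bullet> M"
proof -
  have "(transpose E ** E) \<bullet> M = E \<bullet> (E ** M)"
    by (simp only: inner_matrix_mul_left transpose_transpose)
  also have "\<dots> = (E ** transpose M) \<bullet> E"
    by (simp only: inner_matrix_mul_right transpose_transpose)
  also have "\<dots> = (\<Sum>i\<in>UNIV. (E $ i) \<bullet> (M *v (E $ i)))"
    by (simp only: inner_vec_def[of "E ** transpose M"] mul_transpose_row) (simp add: inner_commute)
  also have "0 \<le> \<dots>" by (intro sum_nonneg assms)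
  finally show ?thesis .
qed

section \<open>Householder reflections and their traces against a matrix\<close>

definition householder :: "real^'n \<Rightarrow> real^'n^'n" where
  "householder u = (\<chi> i j. (if i = j then 1 else 0) - 2 * u $ i * u $ j)"

lemma householder_mult_vec: "householder u *v x = x - (2 * (u \<bullet> x)) *\<^sub>R u"
proof -
  have "(householder u *v x) $ i = (\<Sum>j\<in>UNIV. (if i = j then x $ j else 0) - 2 * u $ i * (u $ j * x $ j))"
    for i
    by (auto simp: householder_def matrix_vector_mult_def left_diff_distrib intro!: sum.cong)
  then show ?thesis
    by (simp add: vec_eq_iff sum_subtractf inner_vec_def flip: sum_distrib_left)
qed

lemma orthogonal_matrix_householder:
  assumes "norm u = 1"
  shows "orthogonal_matrix (householder u)"
proof -
  have "u \<bullet> u = 1" using assms by (simp add: norm_eq_1)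
  then have "(householder u ** householder u) *v x = x" for x
    by (simp add: matrix_vector_mul_assoc[symmetric] householder_mult_vec inner_diff_right
        algebra_simps scaleR_diff_left[symmetric])
  then have "householder u ** householder u = mat 1"
    by (simp add: matrix_eq)
  moreover have "transpose (householder u) = householder u"
    by (simp add: householder_def transpose_def vec_eq_iff)
  ultimately show ?thesis by (simp add: orthogonal_matrix)
qed

lemma inner_householder:
  fixes M :: "real^'n^'n"
  shows "M \<bullet> householder u = M \<bullet> mat 1 - 2 * (u \<bullet> (M *v u))"
proof -
  have "householder u = mat 1 - (\<chi> i j. 2 * u $ i * u $ j)"
    by (simp add: householder_def mat_def vec_eq_iff)
  moreover have "M \<bullet> (\<chi> i j. 2 * u $ i * u $ j) = 2 * (u \<bullet> (M *v u))"
    by (simp add: matrix_inner_eq_sum inner_vec_def matrix_vector_mult_def sum_distrib_left mult_ac)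
  ultimately show ?thesis by (simp add: inner_diff_right)
qed

text \<open>Pairing \<open>M\<close> with the expansion
  \<open>I - 2 u u^T - 2 v v^T + 4 (u . v) u v^T\<close> of the product gives the four
  terms.\<close>

lemma inner_householder_mul:
  fixes M :: "real^'n^'n"
  shows "M \<bullet> (householder u ** householder v) = M \<bullet> mat 1 - 2 * (u \<bullet> (M *v u)) - 2 * (v \<bullet> (M *v v))
    + 4 * (u \<bullet> v) * (u \<bullet> (M *v v))"
proof -
  have "(householder u ** householder v) $ i $ j =
     (householder u + householder v - mat 1 + (\<chi> i j. 4 * (u \<bullet> v) * u $ i * v $ j)) $ i $ j" for i j
  proof -
    have "(householder u ** householder v) $ i $ j = ((householder u ** householder v) *v axis j 1) $ i"
      by (simp add: matrix_vector_mult_basis column_def)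
    also have "\<dots> = (householder v *v axis j 1) $ i - 2 * (u \<bullet> (householder v *v axis j 1)) * u $ i"
      by (simp only: matrix_vector_mul_assoc[symmetric] householder_mult_vec[of u]
          vector_minus_component vector_scaleR_component real_scaleR_def)
    finally have entry: "(householder u ** householder v) $ i $ j =
        (householder v *v axis j 1) $ i - 2 * (u \<bullet> (householder v *v axis j 1)) * u $ i" .
    have col: "householder v *v axis j 1 = axis j 1 - (2 * v $ j) *\<^sub>R v"
      by (simp add: householder_mult_vec inner_axis)
    show ?thesis
      unfolding entry col
      by (simp add: inner_diff_right inner_axis householder_def mat_def algebra_simps)
        (simp add: axis_def)
  qed
  then have eq: "householder u ** householder v =
     householder u + householder v - mat 1 + (\<chi> i j. 4 * (u \<bullet> v) * u $ i * v $ j)"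
    by (simp add: vec_eq_iff)
  have "M \<bullet> (\<chi> i j. 4 * (u \<bullet> v) * u $ i * v $ j) = 4 * (u \<bullet> v) * (u \<bullet> (M *v v))"
    unfolding matrix_inner_eq_sum inner_vec_def[of u "M *v v"]
    by (simp add: matrix_vector_mult_def sum_distrib_left mult_ac)
  then show ?thesis
    unfolding eq by (simp add: inner_add_right inner_diff_right inner_householder)
qed

section \<open>Matrices whose trace no orthogonal factor can increase\<close>

text \<open>The reflection along the unit vector \<open>u = x / norm x\<close> changes the trace by
  \<open>-2 (u . M u)\<close>, which maximality forces to be nonpositive.\<close>

lemma trace_maximal_imp_psd:
  fixes M :: "real^'n^'n"
  assumes max: "\<And>Q. orthogonal_matrix Q \<Longrightarrow> M \<bullet> Q \<le> M \<bullet> mat 1"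
  shows "0 \<le> x \<bullet> (M *v x)"
proof (cases "x = 0")
  case False
  let ?u = "(1 / norm x) *\<^sub>R x"
  have "0 \<le> ?u \<bullet> (M *v ?u)"
    using max[OF orthogonal_matrix_householder[of ?u]] False by (simp add: inner_householder)
  also have "\<dots> = x \<bullet> (M *v x) / (norm x)\<^sup>2"
    by (simp add: matrix_vector_mult_scaleR power2_eq_square)
  finally show ?thesis using False by (simp add: zero_le_divide_iff)
qed simp

text \<open>
  The product of the reflections along \<open>e\<^sub>i\<close> and \<open>c e\<^sub>i + s e\<^sub>j\<close> is a rotation in the plane of \<open>e\<^sub>i\<close>
  and \<open>e\<^sub>j\<close>; its contribution of first order in \<open>s\<close> is the antisymmetric part of \<open>M\<close>.
\<close>
lemma trace_maximal_imp_entry_le: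
  fixes M :: "real^'n^'n"
  assumes max: "\<And>Q. orthogonal_matrix Q \<Longrightarrow> M \<bullet> Q \<le> M \<bullet> mat 1"
  shows "M $ i $ j \<le> M $ j $ i"
proof (cases "i = j")
  case False
  define a where "a = M $ i $ i + M $ j $ j"
  define d where "d = M $ i $ j - M $ j $ i"
  have le: "c * s * d \<le> s\<^sup>2 * a" if cs: "c\<^sup>2 + s\<^sup>2 = 1" for c s
  proof -
    let ?u = "axis i 1 :: real^'n"
    let ?v = "c *\<^sub>R axis i 1 + s *\<^sub>R axis j 1 :: real^'n"
    have ent: "axis k 1 \<bullet> (M *v axis l 1) = M $ k $ l" for k l
      by (simp add: matrix_vector_mult_basis column_def inner_commute[of "axis k 1"] inner_axis)
    have uv: "?u \<bullet> ?v = c"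
      using False by (simp add: inner_add inner_axis_axis)
    have "?v \<bullet> ?v = 1"
      using cs False by (simp add: inner_add inner_axis_axis power2_eq_square)
    then have v1: "norm ?v = 1" by (simp add: norm_eq_1)
    have Mv: "M *v ?v = c *\<^sub>R (M *v axis i 1) + s *\<^sub>R (M *v axis j 1)"
      by (simp add: matrix_vector_right_distrib matrix_vector_mult_scaleR)
    have uMv: "?u \<bullet> (M *v ?v) = c * M $ i $ i + s * M $ i $ j"
      by (simp only: Mv inner_add_right inner_scaleR_right ent)
    have vMv: "?v \<bullet> (M *v ?v) = c\<^sup>2 * M $ i $ i + c * s * M $ i $ j + c * s * M $ j $ i + s\<^sup>2 * M $ j $ j"
      by (simp only: Mv inner_add_right inner_add_left inner_scaleR_left inner_scaleR_right ent)
         (simp add: power2_eq_square algebra_simps)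
    have "orthogonal_matrix (householder ?u ** householder ?v)"
      using v1 by (intro orthogonal_matrix_mul orthogonal_matrix_householder) auto
    from max[OF this]
    have "2 * c * (c * M $ i $ i + s * M $ i $ j) \<le> M $ i $ i +
        (c\<^sup>2 * M $ i $ i + c * s * M $ i $ j + c * s * M $ j $ i + s\<^sup>2 * M $ j $ j)"
      unfolding inner_householder_mul uMv vMv uv ent by simp
    \<comment> \<open>Splitting \<open>M $ i $ i\<close> by \<open>c^2 + s^2 = 1\<close> cancels
      every term in \<open>c^2\<close>, leaving \<open>c * s * d\<close> against
      \<open>s^2 * a\<close>.\<close>
    moreover have "M $ i $ i = c\<^sup>2 * M $ i $ i + s\<^sup>2 * M $ i $ i"
      using cs by (simp add: distrib_right[symmetric])
    ultimately show ?thesis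
      by (simp add: a_def d_def power2_eq_square algebra_simps)
  qed
  \<comment> \<open>Here \<open>t\<close> is the tangent \<open>s / c\<close> of the angle; the
    inequality is divided by \<open>c^2 * t > 0\<close>.\<close>
  have small: "d \<le> t * a" if t: "t > 0" for t
  proof -
    define c where "c = 1 / sqrt (1 + t\<^sup>2)"
    have pos: "1 + t\<^sup>2 > 0" by (simp add: add_pos_nonneg)
    have c2: "c\<^sup>2 * (1 + t\<^sup>2) = 1" using pos by (simp add: c_def power_divide)
    have c0: "c > 0" using pos by (simp add: c_def)
    have "c * (c * t) * d \<le> (c * t)\<^sup>2 * a"
      by (rule le) (use c2 in \<open>simp add: power_mult_distrib algebra_simps\<close>)
    then have "(c\<^sup>2 * t) * d \<le> (c\<^sup>2 * t) * (t * a)"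
      by (simp add: power2_eq_square algebra_simps)
    then show ?thesis using c0 t by (simp add: mult_le_cancel_left)
  qed
  have "d \<le> 0"
  proof (rule ccontr)
    assume "\<not> d \<le> 0"
    then have d: "d > 0" by simp
    \<comment> \<open>This choice makes \<open>t * (1 + \<bar>a\<bar>)\<close> equal to
      \<open>d / 2\<close>; the summand 1 keeps the denominator positive when
      \<open>a = 0\<close>.\<close>
    define t where "t = d / (2 * (1 + \<bar>a\<bar>))"
    have "t > 0" using d by (simp add: t_def add_pos_nonneg)
    have "d \<le> t * a" by (rule small) fact
    also have "\<dots> \<le> t * (1 + \<bar>a\<bar>)" using \<open>t > 0\<close> by (intro mult_left_mono) auto
    also have "\<dots> = d / 2" by (simp add: t_def field_simps add_pos_nonneg)
    finally show False using d by simp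
  qed
  then show ?thesis by (simp add: d_def)
qed simp

lemma trace_maximal_imp_symmetric:
  fixes M :: "real^'n^'n"
  assumes "\<And>Q. orthogonal_matrix Q \<Longrightarrow> M \<bullet> Q \<le> M \<bullet> mat 1"
  shows "transpose M = M"
proof -
  have "M $ j $ i = M $ i $ j" for i j
    by (intro antisym trace_maximal_imp_entry_le assms)
  then show ?thesis by (simp add: transpose_def vec_eq_iff)
qed

section \<open>Optimal alignment and the bound by the difference of \<open>Z Z^T\<close> and
  \<open>Y Y^T\<close>\<close>

text \<open>Since \<open>norm (Y P Q)\<close> does not depend on the orthogonal \<open>Q\<close>,
  minimality of the distance at \<open>P\<close> says that \<open>M . Q\<close> is maximal at
  \<open>Q = I\<close>, where \<open>M = (Y P)^T Z\<close>. The criteria for trace maximality then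
  apply to \<open>M\<close>.\<close>

lemma procrustes_alignment:
  fixes Z Y :: "real^'k^'m"
  obtains P where "orthogonal_matrix P" "procrustes_dist Z Y = norm (Z - Y ** P)"
    "transpose (transpose (Y ** P) ** Z) = transpose (Y ** P) ** Z"
    "\<And>x. 0 \<le> x \<bullet> ((transpose (Y ** P) ** Z) *v x)"
proof -
  obtain P where P: "orthogonal_matrix P" "procrustes_dist Z Y = norm (Z - Y ** P)"
    and min: "\<And>Q. orthogonal_matrix Q \<Longrightarrow> norm (Z - Y ** P) \<le> norm (Z - Y ** Q)"
    using procrustes_dist_attained[of Z Y] by blast
  define M where "M = transpose (Y ** P) ** Z"
  have max: "M \<bullet> Q \<le> M \<bullet> mat 1" if Q: "orthogonal_matrix Q" for Q
  proof -
    have M: "M \<bullet> R = Z \<bullet> (Y ** P ** R)" for R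
      by (simp add: M_def inner_matrix_mul_left)
    have "orthogonal_matrix (P ** Q)" using P Q by (simp add: orthogonal_matrix_mul)
    from min[OF this] have "(norm (Z - Y ** P))\<^sup>2 \<le> (norm (Z - Y ** P ** Q))\<^sup>2"
      by (simp add: matrix_mul_assoc)
    then show ?thesis
      by (simp add: norm_diff_sq M norm_mul_orthogonal P Q)
  qed
  show thesis
    using that[OF P] trace_maximal_imp_symmetric[OF max] trace_maximal_imp_psd[OF max]
    unfolding M_def by blast
qed

text \<open>The number \<open>c\<close> is a lower bound for the eigenvalues of
  \<open>Y^T Y\<close>; it enters only through the estimate of \<open>norm (E X^T)\<close>.\<close>

lemma procrustes_dist_le_gram:
  fixes Z Y :: "real^'k^'m"
  assumes bound: "\<And>x. c * (norm x)\<^sup>2 \<le> (norm (Y *v x))\<^sup>2"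
  shows "2 * (sqrt 2 - 1) * c * (procrustes_dist Z Y)\<^sup>2
    \<le> (norm (Z ** transpose Z - Y ** transpose Y))\<^sup>2"
proof -
  obtain P where P: "orthogonal_matrix P" and dist: "procrustes_dist Z Y = norm (Z - Y ** P)"
    and sym: "transpose (transpose (Y ** P) ** Z) = transpose (Y ** P) ** Z"
    and psd: "\<And>x. 0 \<le> x \<bullet> ((transpose (Y ** P) ** Z) *v x)"
    using procrustes_alignment[of Z Y] by blast
  define X where "X = Y ** P"
  define E where "E = Z - X"
  define H where "H = transpose X ** E"
  define N where "N = transpose E ** E"
  have Z: "Z = X + E" by (simp add: E_def)
  have XX: "X ** transpose X = Y ** transpose Y"
  proof -
    have "X ** transpose X = Y ** (P ** transpose P) ** transpose Y"
      by (simp add: X_def matrix_transpose_mul matrix_mul_assoc)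
    then show ?thesis using P by (simp add: orthogonal_matrix_def)
  qed
  have H: "H = transpose X ** Z - transpose X ** X"
    by (simp add: H_def E_def matrix_mul_diff_right)
  have Hsym: "transpose H = H"
    using sym by (simp add: H transpose_diff X_def matrix_transpose_mul matrix_mul_assoc)
  then have EX: "transpose E ** X = H"
    by (simp add: H_def matrix_transpose_mul)
  define a where "a = (norm (E ** transpose X))\<^sup>2"
  have a: "a = N \<bullet> (transpose X ** X)"
    by (simp add: a_def N_def power2_norm_eq_inner inner_mul_transpose)
  have diff: "Z ** transpose Z - Y ** transpose Y
     = X ** transpose E + E ** transpose X + E ** transpose E"
    by (simp add: XX[symmetric] Z transpose_add matrix_add_ldistrib matrix_add_rdistrib)
  \<comment> \<open>The squares of \<open>X E^T\<close> and \<open>E X^T\<close> are both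
    \<open>a\<close>. Symmetry of \<open>H\<close> makes their mutual product \<open>H . H\<close>
    and the product of each with \<open>E E^T\<close> equal to \<open>N . H\<close>.\<close>
  have "(norm (Z ** transpose Z - Y ** transpose Y))\<^sup>2
     = 2 * a + 2 * (H \<bullet> H) + N \<bullet> N + 4 * (N \<bullet> H)"
    unfolding diff power2_norm_eq_inner inner_add_left inner_add_right inner_mul_transpose EX
      H_def[symmetric] N_def[symmetric] a
    by (simp add: inner_commute)
  \<comment> \<open>The factor \<open>sqrt 2\<close> is the one for which the square absorbs
    \<open>2 (H . H)\<close> exactly.\<close>
  also have "\<dots> = (norm (N + sqrt 2 *\<^sub>R H))\<^sup>2 + (4 - 2 * sqrt 2) * (N \<bullet> H) + 2 * a"
    by (simp add: norm_add_sq power2_norm_eq_inner[of N] power_mult_distrib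
        power2_norm_eq_inner[of H] algebra_simps)
  \<comment> \<open>\<open>N . H\<close> has no definite sign, but \<open>N . (X^T Z)\<close> is
    nonnegative. The exchange costs \<open>(4 - 2 sqrt 2) a\<close>, so
    \<open>2 (sqrt 2 - 1) a\<close> remains of \<open>2 a\<close>.\<close>
  also have "N \<bullet> H = N \<bullet> (transpose X ** Z) - a"
    by (simp add: H inner_diff_right a)
  finally have eq: "(norm (Z ** transpose Z - Y ** transpose Y))\<^sup>2 = (norm (N + sqrt 2 *\<^sub>R H))\<^sup>2
     + (4 - 2 * sqrt 2) * (N \<bullet> (transpose X ** Z)) + 2 * (sqrt 2 - 1) * a"
    by (simp add: algebra_simps)
  have "0 \<le> N \<bullet> (transpose X ** Z)"
    unfolding N_def by (rule inner_gram_psd_nonneg) (use psd in \<open>simp add: X_def\<close>)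
  moreover have "sqrt 2 \<le> (2 :: real)" by (simp add: real_sqrt_le_iff[of 2 4, simplified])
  ultimately have "2 * (sqrt 2 - 1) * a \<le> (norm (Z ** transpose Z - Y ** transpose Y))\<^sup>2"
    unfolding eq by simp
  moreover have "c * (norm E)\<^sup>2 \<le> a"
    unfolding a_def
  proof (rule norm_mul_transpose_lower_bound)
    fix x
    have "norm (P *v x) = norm x"
      using P by (intro orthogonal_transformation_norm) (simp add: orthogonal_transformation_matrix)
    with bound[of "P *v x"] show "c * (norm x)\<^sup>2 \<le> (norm (X *v x))\<^sup>2"
      by (simp add: X_def matrix_vector_mul_assoc)
  qed
  then have "2 * (sqrt 2 - 1) * (c * (norm E)\<^sup>2) \<le> 2 * (sqrt 2 - 1) * a"
    by (intro mult_left_mono) auto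
  ultimately have "2 * (sqrt 2 - 1) * (c * (norm E)\<^sup>2) \<le> (norm (Z ** transpose Z - Y ** transpose Y))\<^sup>2"
    by linarith
  then show ?thesis
    by (simp add: dist E_def X_def mult.assoc)
qed

section \<open>Stacked factors and balancedness\<close>

lemma transpose_vstack_mul:
  fixes A C :: "real^'r^'n1" and B D :: "real^'r^'n2"
  shows "transpose (vstack A B) ** vstack C D = transpose A ** C + transpose B ** D"
proof -
  have split: "(\<Sum>k\<in>UNIV. f k) = (\<Sum>k\<in>UNIV. f (Inl k)) + (\<Sum>k\<in>UNIV. f (Inr k))"
    for f :: "'n1 + 'n2 \<Rightarrow> real"
    by (simp add: UNIV_Plus_UNIV[symmetric] sum.Plus del: UNIV_Plus_UNIV)
  show ?thesis
    by (simp add: vec_eq_iff matrix_matrix_mult_def transpose_def vstack_def split)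
qed

text \<open>With \<open>E = U^T U'\<close> and \<open>F = V^T V'\<close>, the right side minus the
  left side is exactly \<open>2 (norm (E - F))^2\<close>. Balancedness makes the terms in
  \<open>U'\<close> and \<open>V'\<close> alone cancel.\<close>

lemma gram_vstack_diff_le:
  fixes U U' :: "real^'r^'n1" and V V' :: "real^'r^'n2"
  assumes bal: "transpose U' ** U' = transpose V' ** V'"
  defines "Z \<equiv> vstack U V" and "Y \<equiv> vstack U' V'"
  shows "(norm (Z ** transpose Z - Y ** transpose Y))\<^sup>2
    \<le> 4 * (norm (U ** transpose V - U' ** transpose V'))\<^sup>2
      + (norm (transpose U ** U - transpose V ** V))\<^sup>2"
proof -
  define A B where "A = transpose U ** U" and "B = transpose V ** V"
  define E F where "E = transpose U ** U'" and "F = transpose V ** V'"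
  define D where "D = transpose V' ** V'"
  have "(norm (Z ** transpose Z - Y ** transpose Y))\<^sup>2
     = (norm (A + B))\<^sup>2 - 2 * (norm (E + F))\<^sup>2 + (norm (D + D))\<^sup>2"
    unfolding norm_diff_sq unfolding power2_norm_eq_inner inner_mul_transpose Z_def Y_def
      transpose_vstack_mul bal A_def B_def E_def F_def D_def ..
  moreover have "(norm (U ** transpose V - U' ** transpose V'))\<^sup>2 = A \<bullet> B - 2 * (E \<bullet> F) + D \<bullet> D"
    unfolding norm_diff_sq unfolding power2_norm_eq_inner inner_mul_transpose
      bal A_def B_def E_def F_def D_def ..
  moreover have "0 \<le> (norm (E - F))\<^sup>2" by simp
  ultimately show ?thesis
    unfolding A_def[symmetric] B_def[symmetric] norm_diff_sq norm_add_sq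
    by (simp add: power2_norm_eq_inner)
qed

section \<open>Singular values read off from a compact SVD\<close>

lemma diag_matrix_mult_vec: "(diag_matrix d *v x) $ i = d $ i * x $ i"
  by (simp add: diag_matrix_def matrix_vector_mult_def if_distrib[of "\<lambda>a. a * _"] cong: if_cong)

lemma transpose_diag_matrix: "transpose (diag_matrix d) = diag_matrix d"
  by (simp add: diag_matrix_def transpose_def vec_eq_iff)

lemma diag_matrix_mul: "diag_matrix d ** diag_matrix e = diag_matrix (\<chi> i. d $ i * e $ i)"
proof -
  have "(diag_matrix d ** diag_matrix e) *v x = diag_matrix (\<chi> i. d $ i * e $ i) *v x" for x
    unfolding matrix_vector_mul_assoc[symmetric]
    by (simp add: vec_eq_iff diag_matrix_mult_vec)
  then show ?thesis by (simp add: matrix_eq)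
qed

lemma svd_gram:
  assumes "is_svd A U s V"
  shows "transpose A ** A = V ** diag_matrix (\<chi> i. (s $ i)\<^sup>2) ** transpose V"
proof -
  have UU: "transpose U ** U = mat 1" and A: "A = U ** diag_matrix s ** transpose V"
    using assms by (auto simp: is_svd_def)
  have "transpose A ** A
      = V ** diag_matrix s ** (transpose U ** U) ** diag_matrix s ** transpose V"
    by (simp add: A matrix_transpose_mul transpose_diag_matrix matrix_mul_assoc)
  also have "\<dots> = V ** (diag_matrix s ** diag_matrix s) ** transpose V"
    by (simp add: UU matrix_mul_assoc)
  finally show ?thesis by (simp add: diag_matrix_mul power2_eq_square)
qed

text \<open>The injective map \<open>V\<close> carries the coordinate subspace of the indices with
  \<open>s $ i = t\<close> onto the eigenspace of \<open>A^T A\<close> for \<open>t^2\<close>.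
  Positivity of \<open>t\<close> matters: the eigenspace for 0 also contains the orthogonal
  complement of the range of \<open>V\<close>.\<close>

lemma svd_singular_multiplicity:
  fixes A :: "real^'n2^'n1" and s :: "real^'r"
  assumes svd: "is_svd A U s V" and t: "t > 0"
  shows "singular_multiplicity A t = card {i. s $ i = t}"
proof -
  have VV: "transpose V ** V = mat 1" and s: "\<And>i. 0 \<le> s $ i"
    using svd by (auto simp: is_svd_def)
  let ?D = "diag_matrix (\<chi> i. (s $ i)\<^sup>2)"
  let ?W = "{y :: real^'r. \<forall>i. i \<notin> {i. s $ i = t} \<longrightarrow> y $ i = 0}"
  have VVx: "transpose V *v (V *v y) = y" for y
    by (simp only: matrix_vector_mul_assoc VV matrix_vector_mul_lid)
  have inj: "inj ((*v) V)"
    by (rule injI) (metis VVx)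
  have gram: "(transpose A ** A) *v x = V *v (?D *v (transpose V *v x))" for x
    by (simp only: svd_gram[OF svd] matrix_vector_mul_assoc matrix_mul_assoc)
  have D: "?D *v y = t\<^sup>2 *\<^sub>R y \<longleftrightarrow> y \<in> ?W" for y
  proof -
    have "(s $ i)\<^sup>2 * y $ i = t\<^sup>2 * y $ i \<longleftrightarrow> (s $ i \<noteq> t \<longrightarrow> y $ i = 0)" for i
      using s[of i] t by (auto simp: power2_eq_iff_nonneg)
    then show ?thesis by (simp add: vec_eq_iff diag_matrix_mult_vec)
  qed
  have "{x. (transpose A ** A) *v x = t\<^sup>2 *\<^sub>R x} = (*v) V ` ?W"
  proof (intro equalityI subsetI)
    fix x assume "x \<in> {x. (transpose A ** A) *v x = t\<^sup>2 *\<^sub>R x}"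
    then have eq: "V *v (?D *v (transpose V *v x)) = t\<^sup>2 *\<^sub>R x" by (simp add: gram)
    then have "transpose V *v (V *v (?D *v (transpose V *v x))) = t\<^sup>2 *\<^sub>R (transpose V *v x)"
      by (simp add: matrix_vector_mult_scaleR)
    then have Dx: "?D *v (transpose V *v x) = t\<^sup>2 *\<^sub>R (transpose V *v x)"
      by (simp only: VVx)
    \<comment> \<open>Dividing by \<open>t^2\<close> shows that the eigenvector lies in the range of
      \<open>V\<close>.\<close>
    then have "t\<^sup>2 *\<^sub>R x = t\<^sup>2 *\<^sub>R (V *v (transpose V *v x))"
      using eq by (simp only: matrix_vector_mult_scaleR)
    then have "x = V *v (transpose V *v x)" using t by simp
    with Dx show "x \<in> (*v) V ` ?W" unfolding D by blast
  next
    fix x assume "x \<in> (*v) V ` ?W"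
    then obtain y where y: "y \<in> ?W" "x = V *v y" by blast
    then have "?D *v y = t\<^sup>2 *\<^sub>R y" by (simp only: D)
    then show "x \<in> {x. (transpose A ** A) *v x = t\<^sup>2 *\<^sub>R x}"
      by (simp only: mem_Collect_eq gram y(2) VVx matrix_vector_mult_scaleR)
  qed
  then have "singular_multiplicity A t = dim ((*v) V ` ?W)"
    by (simp add: singular_multiplicity_def)
  also have "\<dots> = dim ?W"
    by (rule eucl.dim_image_eq) (use inj in \<open>auto intro: inj_on_subset\<close>)
  also have "\<dots> = card {i. s $ i = t}"
    by (simp only: dim_vec_eq[symmetric] dim_substandard_cart)
  finally show ?thesis .
qed

text \<open>A zero entry would make \<open>diag_matrix s\<close> singular, yet its rank is at least
  that of \<open>A\<close>.\<close>

lemma svd_full_rank_pos: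
  fixes A :: "real^'n2^'n1" and s :: "real^'r"
  assumes svd: "is_svd A U s V" and rank: "rank A = CARD('r)"
  shows "0 < s $ i"
proof (rule ccontr)
  assume "\<not> 0 < s $ i"
  with svd have si: "s $ i = 0" by (metis is_svd_def order_le_less)
  have A: "A = U ** diag_matrix s ** transpose V" using svd by (simp add: is_svd_def)
  have "rank A \<le> rank (U ** diag_matrix s)" unfolding A by (rule rank_mul_le_left)
  also have "\<dots> \<le> rank (diag_matrix s)" by (rule rank_mul_le_right)
  finally have "rank (diag_matrix s) = CARD('r)"
    using rank rank_bound[of "diag_matrix s"] by simp
  then have "inj ((*v) (diag_matrix s))" by (simp add: full_rank_injective)
  moreover have "diag_matrix s *v axis i 1 = diag_matrix s *v 0"
    by (simp add: vec_eq_iff diag_matrix_mult_vec axis_def si)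
  ultimately have "axis i 1 = (0 :: real^'r)" by (rule injD)
  then show False by simp
qed

lemma concat_replicate_last_nth:
  assumes "xs \<noteq> []" "0 < m (last xs)" "length (concat (map (\<lambda>x. replicate (m x) x) xs)) = n"
  shows "concat (map (\<lambda>x. replicate (m x) x) xs) ! (n - 1) = last xs"
proof -
  let ?l = "concat (map (\<lambda>x. replicate (m x) x) xs)"
  have xs: "xs = butlast xs @ [last xs]" using assms by simp
  have eq: "?l = concat (map (\<lambda>x. replicate (m x) x) (butlast xs)) @ replicate (m (last xs)) (last xs)"
    by (subst xs) (simp del: append_butlast_last_id)
  then have "?l \<noteq> []" using assms by auto
  moreover have "last ?l = last xs" unfolding eq using assms by (simp add: last_append)
  ultimately show ?thesis using assms(3) by (simp add: last_conv_nth)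
qed

text \<open>The list of singular values begins with the entries of \<open>s\<close> in decreasing
  order, \<open>CARD('r)\<close> in number, and only zeros can follow. Position
  \<open>CARD('r) - 1\<close> therefore holds the smallest entry.\<close>

lemma svd_singular_value_eq_Min:
  fixes A :: "real^'n2^'n1" and s :: "real^'r"
  assumes svd: "is_svd A U s V" and pos: "\<And>i. 0 < s $ i"
  shows "singular_value CARD('r) A = Min (range (($) s))"
proof -
  let ?T = "range (($) s)"
  let ?S = "{t. 0 \<le> t \<and> 0 < singular_multiplicity A t}"
  let ?f = "\<lambda>t. replicate (singular_multiplicity A t) t"
  let ?L = "rev (sorted_list_of_set ?T)"
  let ?l = "concat (map ?f ?L)"
  have mult: "singular_multiplicity A t = card {i. s $ i = t}" if "t > 0" for t
    using svd_singular_multiplicity[OF svd that] .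
  have mem: "t \<in> ?S \<longleftrightarrow> t \<in> ?T" if "t > 0" for t
    using that by (auto simp: mult card_gt_0_iff)
  have Tpos: "t > 0" if "t \<in> ?T" for t using that pos by auto
  \<comment> \<open>A possible singular value 0 is least, so after the reversal its block comes last
    and leaves the prefix \<open>?l\<close> intact.\<close>
  have "sorted_list_of_set ?S = sorted_list_of_set ?T
      \<or> sorted_list_of_set ?S = 0 # sorted_list_of_set ?T"
  proof (cases "0 \<in> ?S")
    case False
    then have "?S = ?T"
      using mem Tpos by (metis (mono_tags, lifting) mem_Collect_eq order_le_less subsetI subset_antisym)
    then show ?thesis by simp
  next
    case True
    have "?S = insert 0 ?T"
    proof (intro set_eqI)
      fix t show "t \<in> ?S \<longleftrightarrow> t \<in> insert 0 ?T"
        using True mem[of t] Tpos[of t] by (cases "t > 0"; cases "t = 0") auto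
    qed
    moreover have "sorted_list_of_set (insert 0 ?T) = insort 0 (sorted_list_of_set ?T)"
      by (intro sorted_list_of_set_insert) (use Tpos[of 0] in auto)
    moreover have "insort 0 (sorted_list_of_set ?T) = 0 # sorted_list_of_set ?T"
      by (intro insort_is_Cons) (use Tpos in \<open>force intro: less_imp_le\<close>)
    ultimately show ?thesis by simp
  qed
  then obtain zs where zs: "singular_values A = ?l @ zs"
    unfolding singular_values_def by (elim disjE) simp_all
  \<comment> \<open>The fibres of \<open>s\<close> over its distinct values partition the index
    type.\<close>
  have "length ?l = sum_list (map (\<lambda>t. card {i. s $ i = t}) ?L)"
    by (simp add: length_concat comp_def, intro arg_cong[of _ _ sum_list] map_cong)
      (auto simp: mult pos rev_map)
  also have "\<dots> = (\<Sum>t\<in>?T. card {i. s $ i = t})"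
    by (subst sum_list_distinct_conv_sum_set) auto
  also have "\<dots> = card (UNIV :: 'r set)"
    by (subst card_UN_disjoint[symmetric]) (auto intro: arg_cong[where f=card])
  finally have len: "length ?l = CARD('r)" .
  have ne: "sorted_list_of_set ?T \<noteq> []"
    by (simp add: sorted_list_of_set_eq_Nil_iff)
  have last: "last ?L = Min ?T"
    using sorted_list_of_set_nonempty[of ?T] by (simp add: last_rev)
  have MinT: "Min ?T \<in> ?T" by (rule Min_in) auto
  have "singular_value CARD('r) A = ?l ! (CARD('r) - 1)"
    unfolding singular_value_def zs using len by (simp add: nth_append)
  also have "\<dots> = last ?L"
  proof (rule concat_replicate_last_nth)
    show "0 < singular_multiplicity A (last ?L)"
      unfolding last using MinT mem[OF Tpos[OF MinT]] by blast
  qed (use ne len in auto)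
  finally show ?thesis by (simp only: last)
qed

section \<open>The distance bound for a balanced SVD\<close>

theorem lemmaB4:
  fixes Xs :: "real^'n2^'n1" and Zs :: "real^'r^('n1 + 'n2)"
    and U :: "real^'r^'n1" and V :: "real^'r^'n2"
  assumes "rank Xs = CARD('r)"
    and "is_balanced_svd Xs Zs"
  shows "(procrustes_dist (vstack U V) Zs)\<^sup>2 \<le>
    1 / ((sqrt 2 - 1) * singular_value CARD('r) Xs) *
      ((norm (U ** transpose V - Xs))\<^sup>2 +
       1/4 * (norm (transpose U ** U - transpose V ** V))\<^sup>2)"
proof -
  obtain A s B where svd: "is_svd Xs A s B"
    and Zs: "Zs = vstack (A ** diag_matrix (\<chi> i. sqrt (s $ i))) (B ** diag_matrix (\<chi> i. sqrt (s $ i)))"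
    using assms(2) unfolding is_balanced_svd_def by blast
  define R where "R = diag_matrix (\<chi> i. sqrt (s $ i))"
  define \<sigma> where "\<sigma> = singular_value CARD('r) Xs"
  have pos: "0 < s $ i" for i using svd_full_rank_pos[OF svd assms(1)] .
  have \<sigma>: "\<sigma> = Min (range (($) s))"
    unfolding \<sigma>_def using svd pos by (rule svd_singular_value_eq_Min)
  have \<sigma>_pos: "\<sigma> > 0" unfolding \<sigma> using pos by (subst Min_gr_iff) auto
  have \<sigma>_le: "\<sigma> \<le> s $ i" for i unfolding \<sigma> by (rule Min_le) auto
  have RR: "R ** R = diag_matrix s"
    unfolding R_def diag_matrix_mul using pos
    by (intro arg_cong[of _ _ diag_matrix]) (simp add: vec_eq_iff less_imp_le)
  have tR: "transpose R = R" by (simp add: R_def transpose_diag_matrix)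
  have gram: "transpose (C ** R) ** (C ** R) = diag_matrix s" if "transpose C ** C = mat 1"
    for C :: "real^'r^'l"
  proof -
    have "transpose (C ** R) ** (C ** R) = R ** (transpose C ** C) ** R"
      by (simp add: matrix_transpose_mul tR matrix_mul_assoc)
    then show ?thesis by (simp add: that RR)
  qed
  have orth: "transpose A ** A = mat 1" "transpose B ** B = mat 1"
    and Xs: "Xs = A ** diag_matrix s ** transpose B"
    using svd by (auto simp: is_svd_def)
  have bal: "(A ** R) ** transpose (B ** R) = Xs"
    by (simp add: Xs matrix_transpose_mul tR RR[symmetric] matrix_mul_assoc)
  have ZZ: "transpose Zs ** Zs = diag_matrix s + diag_matrix s"
    by (simp add: Zs transpose_vstack_mul gram orth flip: R_def)
  \<comment> \<open>Both blocks of \<open>Zs\<close> have Gram matrix \<open>diag_matrix s\<close>,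
    hence the factor 2 in the constant passed to \<open>procrustes_dist_le_gram\<close>.\<close>
  have low: "(2 * \<sigma>) * (norm x)\<^sup>2 \<le> (norm (Zs *v x))\<^sup>2" for x
  proof -
    have "(norm (Zs *v x))\<^sup>2 = ((transpose Zs ** Zs) *v x) \<bullet> x"
      by (simp only: power2_norm_eq_inner matrix_vector_mul_assoc[symmetric]
          transpose_matrix_vector dot_lmul_matrix)
    also have "\<dots> = 2 * ((diag_matrix s *v x) \<bullet> x)"
      by (simp only: ZZ matrix_vector_mult_add_rdistrib inner_add_left mult_2)
    also have "\<dots> = (\<Sum>i\<in>UNIV. 2 * s $ i * (x $ i)\<^sup>2)"
      by (simp add: inner_vec_def diag_matrix_mult_vec power2_eq_square sum_distrib_left mult_ac)
    also have "\<dots> \<ge> (\<Sum>i\<in>UNIV. 2 * \<sigma> * (x $ i)\<^sup>2)"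
      by (intro sum_mono mult_right_mono mult_left_mono \<sigma>_le) auto
    also have "(\<Sum>i\<in>UNIV. 2 * \<sigma> * (x $ i)\<^sup>2) = (2 * \<sigma>) * (norm x)\<^sup>2"
      by (simp only: power2_norm_eq_inner inner_vec_def sum_distrib_left)
        (simp add: power2_eq_square)
    finally show ?thesis .
  qed
  have "2 * (sqrt 2 - 1) * (2 * \<sigma>) * (procrustes_dist (vstack U V) Zs)\<^sup>2
     \<le> (norm (vstack U V ** transpose (vstack U V) - Zs ** transpose Zs))\<^sup>2"
    by (rule procrustes_dist_le_gram) (rule low)
  also have "\<dots> \<le> 4 * (norm (U ** transpose V - Xs))\<^sup>2
      + (norm (transpose U ** U - transpose V ** V))\<^sup>2"
    using gram_vstack_diff_le[of "A ** R" "B ** R" U V]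
    by (simp add: gram orth bal Zs flip: R_def)
  \<comment> \<open>The left factor is \<open>4 (sqrt 2 - 1) \<sigma>\<close>; dividing by 4
    produces the weights 1 and \<open>1/4\<close>.\<close>
  finally have "((sqrt 2 - 1) * \<sigma>) * (procrustes_dist (vstack U V) Zs)\<^sup>2
     \<le> (norm (U ** transpose V - Xs))\<^sup>2
      + 1/4 * (norm (transpose U ** U - transpose V ** V))\<^sup>2"
    by (simp add: algebra_simps)
  moreover have "(sqrt 2 - 1) * \<sigma> > 0" using \<sigma>_pos by simp
  ultimately show ?thesis
    unfolding \<sigma>_def[symmetric] by (simp add: pos_le_divide_eq mult.commute)
qed

end
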